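(* Under the von Mises flat model with parameters $(N,K,\kappa)$, as $N\to\infty$, weak detection is impossible when $K=N^\alpha$ for some constant $0<\alpha<1/2$ and $\frac1{\sqrt\kappa}=\frac{K^2}{c\,N\log N}$ for some constant $c>0$ with $c<\frac{1-2\alpha}{2\sqrt\pi}$.
   Context: $I_0(\kappa)=\frac1{2\pi}\int_0^{2\pi}e^{\kappa\cos u}\,du$. $\mathrm{vonMises}(\Theta,\kappa)$ ($\kappa>0$) is the distribution on $[0,2\pi)$ with density $\frac{1}{2\pi I_0(\kappa)}\exp(\kappa\cos(\theta-\Theta))$. Von Mises flat model $(N,K,\kappa)$, with $1\le K\le N$ an integer and $\kappa>0$ (both possibly depending on $N$): angles $X=(X_1,\dots,X_N)\in[0,2\pi)^N$ are observed. Under $H_0$ (law $\mathbb{Q}$) the $X_i$ are i.i.d. uniform on $[0,2\pi)$. Under $H_1$ (law $\mathbb{P}$), a subset $S^*\subset[N]$ is drawn uniformly at random among subsets of size $K$, a phase $\Theta^*$ is drawn independently and uniformly on $[0,2\pi)$, and given $(S^*,\Theta^* )$ the $X_i$ are independent with $X_i\sim\mathrm{vonMises}(\Theta^*,\kappa)$ for $i\in S^*$ and $X_i$ uniform on $[0,2\pi)$ for $i\notin S^*$. $\mathbb{P}$ is the resulting mixture law of $X$. $K=N^\alpha$ is understood up to rounding to an integer. $\log$ is the natural logarithm. A test is a measurable function $\phi$ of the data with values in $\{0,1\}$ ($1$ means reject $H_0$). $p_{\mathrm{fa}}(\phi)=\mathbb{Q}\{\phi(X)=1\}$ and $p_{\mathrm{miss}}(\phi)=\mathbb{P}\{\phi(X)=0\}$.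 Weak detection is impossible if every sequence of tests satisfies $p_{\mathrm{fa}}+p_{\mathrm{miss}}\ge 1-o(1)$; equivalently the total variation distance between $\mathbb{P}$ and $\mathbb{Q}$ tends to $0$. *)

theory Defs
  imports "HOL-Probability.Probability"
begin

definition bessel_I0 :: "real \<Rightarrow> real" where
  "bessel_I0 \<kappa> = 1 / (2 * pi) * (LBINT u:{0..2*pi}. exp (\<kappa> * cos u))"

definition angles :: "real measure" where
  "angles = restrict_space lborel {0..<2*pi}"

definition uniform_angle :: "real measure" where
  "uniform_angle = uniform_measure angles {0..<2*pi}"

definition vonMises :: "real \<Rightarrow> real \<Rightarrow> real measure" where
  "vonMises \<Theta> \<kappa> =
     density angles (\<lambda>\<theta>. ennreal (1 / (2 * pi * bessel_I0 \<kappa>) * exp (\<kappa> * cos (\<theta> - \<Theta>))))"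

definition flat_null :: "nat \<Rightarrow> (nat \<Rightarrow> real) measure" where
  "flat_null N = PiM {..<N} (\<lambda>_. uniform_angle)"

definition flat_conditional ::
    "nat \<Rightarrow> real \<Rightarrow> nat set \<Rightarrow> real \<Rightarrow> (nat \<Rightarrow> real) measure" where
  "flat_conditional N \<kappa> S \<Theta> =
     PiM {..<N} (\<lambda>i. if i \<in> S then vonMises \<Theta> \<kappa> else uniform_angle)"

text \<open>
  The Giry-monad mixture over the independent pair of a uniform \<open>K\<close>-subset and a uniform phase.
  It is meaningful for \<open>K \<le> N\<close>; otherwise there is no \<open>K\<close>-subset and
  \<^const>\<open>pmf_of_set\<close> is unspecified.
\<close>

definition flat_planted :: "nat \<Rightarrow> nat \<Rightarrow> real \<Rightarrow> (nat \<Rightarrow> real) measure" where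
  "flat_planted N K \<kappa> =
     measure_pmf (pmf_of_set {S. S \<subseteq> {..<N} \<and> card S = K}) \<bind> (\<lambda>S.
       uniform_angle \<bind> (\<lambda>\<Theta>. flat_conditional N \<kappa> S \<Theta>))"

text \<open>Tests are Boolean-valued, with \<^term>\<open>True\<close> meaning rejection of the null hypothesis.\<close>

definition p_fa :: "'a measure \<Rightarrow> ('a \<Rightarrow> bool) \<Rightarrow> real" where
  "p_fa Q \<phi> = measure Q {x \<in> space Q. \<phi> x}"

definition p_miss :: "'a measure \<Rightarrow> ('a \<Rightarrow> bool) \<Rightarrow> real" where
  "p_miss P \<phi> = measure P {x \<in> space P. \<not> \<phi> x}"

text \<open>
  \<open>P N\<close> and \<open>Q N\<close> are meant to live on the same measurable space, so
  measurability of a test is expressed through \<open>Q N\<close> alone.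
\<close>

definition weak_detection_impossible ::
    "(nat \<Rightarrow> 'a measure) \<Rightarrow> (nat \<Rightarrow> 'a measure) \<Rightarrow> bool" where
  "weak_detection_impossible P Q \<longleftrightarrow>
     (\<forall>\<phi>. (\<forall>N. \<phi> N \<in> measurable (Q N) (count_space UNIV)) \<longrightarrow>
        (\<exists>r :: nat \<Rightarrow> real. r \<longlonglongrightarrow> 0 \<and>
           (\<forall>\<^sub>F N in sequentially. p_fa (Q N) (\<phi> N) + p_miss (P N) (\<phi> N) \<ge> 1 - r N)))"

end

theory Submission
  imports Defs "HOL-Real_Asymp.Real_Asymp"
begin

text \<open>
  The proof is a second moment computation. Let \<open>L\<close> be the likelihood ratio of the planted law with respect to
  the null law. For every test the sum of the two error probabilities is at least \<open>1 - sqrt (E L\<^sup>2 - 1)\<close>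
  (\<open>mixture_discrepancy_le\<close>), where \<open>E\<close> is the mean under the null law, so it suffices that \<open>E L\<^sup>2\<close> tends to 1.

  Expanding \<open>L\<^sup>2\<close> over two independent copies \<open>(S, s)\<close> and \<open>(T, t)\<close> of the planted subset and phase, and using that the
  coordinates are independent, one gets \<open>E L\<^sup>2\<close> as the average of \<open>\<rho> (s, t) ^ card (S \<inter> T)\<close>, where \<open>\<rho> (s, t)\<close>
  is the correlation of two von Mises likelihood ratios (\<open>vm_overlap\<close>). Two facts about \<open>\<rho>\<close> matter. Its average over \<open>t\<close> is 1.
  Its maximum is at most \<open>B = 2 * sqrt (pi * \<kappa>)\<close> for large \<open>\<kappa>\<close> (\<open>vm_peak_le\<close>), because \<open>\<rho> (s, t)\<close> stays comparable to its maximum as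
  long as \<open>s - t\<close> is of order \<open>1 / sqrt \<kappa>\<close>, and the average 1 leaves no room for a higher peak. Together they show that the average
  of \<open>\<rho> ^ m\<close> over the phases is at most \<open>1 + B ^ m / B\<close> (\<open>vm_overlap_moment\<close>).

  It remains to average \<open>B ^ card (S \<inter> T)\<close> over uniform \<open>K\<close>-subsets. As these contain \<open>j\<close> given points with probability at
  most \<open>(K / N) ^ j\<close>, the average is at most \<open>exp (B * K\<^sup>2 / N)\<close> (\<open>overlap_mgf\<close>). Hence \<open>E L\<^sup>2 - 1 \<le> exp (B * K\<^sup>2 / N) / B\<close>.
  In the given scaling \<open>B * K\<^sup>2 / N = 2 * sqrt pi * c * ln N\<close>, while \<open>1 / B\<close> is of order \<open>N powr (2 * \<alpha> - 1) / ln N\<close>, so the bound is of order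
  \<open>N powr (2 * sqrt pi * c + 2 * \<alpha> - 1) / ln N\<close>. The condition on \<open>c\<close> says exactly that this power of \<open>N\<close> has a negative exponent.
\<close>

section \<open>The uniform angle and the von Mises likelihood ratio\<close>

lemma space_uniform_angle [simp]: "space uniform_angle = {0..<2*pi}"
  by (simp add: uniform_angle_def angles_def space_restrict_space)

lemma sets_uniform_angle: "sets uniform_angle = sets (restrict_space borel {0..<2*pi})"
  by (simp add: uniform_angle_def angles_def sets_restrict_space)

text \<open>
  The carrier of \<^const>\<open>uniform_angle\<close> is a proper subset of the reals. Composing with the inclusion lets
  real-valued measurability be derived from measurability into this space.
\<close>

lemma measurable_uniform_angle [measurable (raw)]:
  "f \<in> M \<rightarrow>\<^sub>M uniform_angle \<Longrightarrow> f \<in> borel_measurable M"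
  by (rule measurable_compose[where g = "\<lambda>x. x" and N = uniform_angle])
     (auto simp: measurable_cong_sets[OF sets_uniform_angle refl] intro!: measurable_restrict_space1)

lemma emeasure_angles: "emeasure angles {0..<2*pi} = ennreal (2*pi)"
  by (simp add: angles_def emeasure_restrict_space)

lemma uniform_angle_density: "uniform_angle = density angles (\<lambda>_. ennreal (1/(2*pi)))"
proof -
  have "1 / ennreal (2*pi) = ennreal (1/(2*pi))"
    by (simp add: divide_ennreal flip: ennreal_1)
  thus ?thesis
  unfolding uniform_angle_def uniform_measure_def emeasure_angles
  by (intro density_cong) (auto simp: angles_def space_restrict_space intro!: measurable_restrict_space1)
qed

lemma prob_space_uniform_angle: "prob_space uniform_angle"
  unfolding uniform_angle_def
  by (intro prob_space_uniform_measure) (simp_all add: emeasure_angles)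

lemma measure_uniform_angle_space [simp]: "measure uniform_angle {0..<2*pi} = 1"
  using prob_space.prob_space[OF prob_space_uniform_angle] by simp

text \<open>
  The half-open carrier and the closed interval differ by a null set. Passing to the
  Henstock-Kurzweil integral makes splitting, shifting and the fundamental theorem of calculus available.
\<close>

lemma integral_uniform_angle:
  fixes h :: "real \<Rightarrow> real"
  assumes "continuous_on UNIV h"
  shows "integral\<^sup>L uniform_angle h = integral {0..2*pi} h / (2*pi)"
proof -
  have [measurable]: "h \<in> borel_measurable borel"
    using assms by (rule borel_measurable_continuous_onI)
  have "integral\<^sup>L uniform_angle h = (\<integral>x. 1/(2*pi) * h x \<partial>angles)"
    unfolding uniform_angle_density
    by (subst integral_density) (auto simp: angles_def intro!: measurable_restrict_space1)
  also have "\<dots> = (LBINT x:{0..<2*pi}. h x) / (2*pi)"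
    by (simp add: angles_def integral_restrict_space set_lebesgue_integral_def)
  also have "(LBINT x:{0..<2*pi}. h x) = (LBINT x:{0..2*pi}. h x)"
    unfolding set_lebesgue_integral_def
    by (intro integral_cong_AE) (auto intro: AE_I[where N = "{2*pi}"] AE_mp[OF AE_lborel_singleton[of "2*pi"]]
        simp: indicator_def)
  also have "\<dots> = integral {0..2*pi} h"
    using borel_integrable_atLeastAtMost'[of 0 "2*pi" h] continuous_on_subset[OF assms]
    by (intro set_borel_integral_eq_integral) auto
  finally show ?thesis .
qed

text \<open>
  Cut the interval at \<open>t\<close>. Periodicity moves the piece \<open>{0..t}\<close> by one full turn, after which the two shifted
  pieces tile \<open>{0..2*pi}\<close> again. Rotations by at most one turn are all that phases require.
\<close>

lemma integral_uniform_angle_rotate: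
  fixes h :: "real \<Rightarrow> real"
  assumes cont: "continuous_on UNIV h" and per: "\<And>x. h (x + 2*pi) = h x"
    and t: "t \<in> {0..2*pi}"
  shows "(\<integral>u. h (u - t) \<partial>uniform_angle) = integral\<^sup>L uniform_angle h"
proof -
  have c: "continuous_on A h" for A using continuous_on_subset[OF cont] by auto
  have i: "h integrable_on {a..b}" for a b by (rule integrable_continuous_real[OF c])
  have c': "continuous_on A (\<lambda>u. h (u - t))" for A
    by (rule continuous_on_compose2[OF cont]) (auto intro!: continuous_intros)
  have "integral {0..2*pi} (\<lambda>u. h (u - t)) = integral {0..t} (\<lambda>u. h (u - t)) + integral {t..2*pi} (\<lambda>u. h (u - t))"
    using t by (intro Henstock_Kurzweil_Integration.integral_combine[symmetric] integrable_continuous_real c') auto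
  also have "integral {t..2*pi} (\<lambda>u. h (u - t)) = integral {0..2*pi-t} h"
    using integral_shift[where a = t and b = "2*pi" and c = "-t" and f = h] c by (simp add: o_def)
  also have "integral {0..t} (\<lambda>u. h (u - t)) = integral {0..t} (\<lambda>u. h (u + (2*pi - t)))"
    by (intro integral_cong) (use per[of "x - t" for x] in \<open>simp add: algebra_simps\<close>)
  also have "\<dots> = integral {2*pi-t..2*pi} h"
    using integral_shift[where a = 0 and b = t and c = "2*pi-t" and f = h] c by (simp add: o_def)
  also have "integral {2*pi-t..2*pi} h + integral {0..2*pi-t} h = integral {0..2*pi} h"
    using Henstock_Kurzweil_Integration.integral_combine[of 0 "2*pi-t" "2*pi" h] t i by simp
  finally show ?thesis
    using integral_uniform_angle[OF c'] integral_uniform_angle[OF cont] by simp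
qed

lemma bessel_I0_eq: "bessel_I0 \<kappa> = (\<integral>u. exp (\<kappa> * cos u) \<partial>uniform_angle)"
proof -
  have "(LBINT u:{0..2*pi}. exp (\<kappa> * cos u)) = integral {0..2*pi} (\<lambda>u. exp (\<kappa> * cos u))"
    by (intro set_borel_integral_eq_integral borel_integrable_atLeastAtMost' continuous_intros)
  thus ?thesis
    by (subst integral_uniform_angle) (auto simp: bessel_I0_def intro!: continuous_intros)
qed

lemma integrable_uniform_angle:
  fixes h :: "real \<Rightarrow> real"
  assumes "continuous_on UNIV h"
  shows "integrable uniform_angle h"
proof -
  interpret prob_space uniform_angle by (rule prob_space_uniform_angle)
  have [measurable]: "h \<in> borel_measurable borel"
    using assms by (rule borel_measurable_continuous_onI)
  have "compact (h ` {0..2*pi})"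
    using assms by (intro compact_continuous_image) (auto intro: continuous_on_subset)
  then obtain B where "\<And>x. x \<in> {0..2*pi} \<Longrightarrow> norm (h x) \<le> B"
    by (metis compact_imp_bounded bounded_iff imageI)
  thus ?thesis by (intro integrable_const_bound[where B = B]) auto
qed

lemma bessel_I0_pos: "0 < bessel_I0 \<kappa>"
proof -
  interpret prob_space uniform_angle by (rule prob_space_uniform_angle)
  have i: "integrable uniform_angle (\<lambda>u. exp (\<kappa> * cos u))"
    by (intro integrable_uniform_angle continuous_intros)
  have "exp (-\<bar>\<kappa>\<bar>) \<le> exp (\<kappa> * cos u)" for u
    using abs_le_D2[of "\<kappa> * cos u" "\<bar>\<kappa>\<bar>"] mult_left_mono[OF abs_cos_le_one, of "\<bar>\<kappa>\<bar>" u] by (simp add: abs_mult)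
  hence "(\<integral>u. exp (-\<bar>\<kappa>\<bar>) \<partial>uniform_angle) \<le> bessel_I0 \<kappa>"
    unfolding bessel_I0_eq by (intro integral_mono i) auto
  hence "exp (-\<bar>\<kappa>\<bar>) \<le> bessel_I0 \<kappa>" by (simp add: prob_space)
  thus ?thesis using exp_gt_zero[of "-\<bar>\<kappa>\<bar>"] by linarith
qed

text \<open>
  The density of \<^term>\<open>vonMises \<Theta> \<kappa>\<close> with respect to the uniform angle is \<open>\<theta> \<mapsto> vm_ratio \<kappa> (\<theta> - \<Theta>)\<close>:
  the factor \<open>2 * pi\<close> of the Lebesgue density cancels against the uniform one.
\<close>

definition vm_ratio :: "real \<Rightarrow> real \<Rightarrow> real" where
  "vm_ratio \<kappa> x = exp (\<kappa> * cos x) / bessel_I0 \<kappa>"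

lemma vm_ratio_pos: "0 < vm_ratio \<kappa> x"
  by (simp add: vm_ratio_def bessel_I0_pos)

lemma vm_ratio_le:
  "\<kappa> > 0 \<Longrightarrow> vm_ratio \<kappa> x \<le> exp \<kappa> / bessel_I0 \<kappa>"
  using bessel_I0_pos by (simp add: vm_ratio_def divide_right_mono less_imp_le)

lemma continuous_on_vm_ratio [continuous_intros]:
  fixes f :: "real \<Rightarrow> real"
  assumes "continuous_on A f"
  shows "continuous_on A (\<lambda>x. vm_ratio \<kappa> (f x))"
  using bessel_I0_pos[of \<kappa>] unfolding vm_ratio_def by (auto intro!: continuous_intros assms)

lemma measurable_vm_ratio [measurable]: "vm_ratio \<kappa> \<in> borel_measurable borel"
  by (intro borel_measurable_continuous_onI continuous_intros)

lemma vm_ratio_periodic: "vm_ratio \<kappa> (x + 2*pi) = vm_ratio \<kappa> x"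
  by (simp add: vm_ratio_def)

lemma integral_vm_ratio:
  assumes "t \<in> {0..2*pi}"
  shows "(\<integral>u. vm_ratio \<kappa> (u - t) \<partial>uniform_angle) = 1"
proof -
  have "(\<integral>u. vm_ratio \<kappa> (u - t) \<partial>uniform_angle) = (\<integral>u. vm_ratio \<kappa> u \<partial>uniform_angle)"
    by (intro integral_uniform_angle_rotate assms continuous_intros vm_ratio_periodic)
  also have "\<dots> = 1"
    using bessel_I0_pos[of \<kappa>] by (simp add: vm_ratio_def flip: bessel_I0_eq)
  finally show ?thesis .
qed

lemma vonMises_density:
  "vonMises \<Theta> \<kappa> = density uniform_angle (\<lambda>\<theta>. ennreal (vm_ratio \<kappa> (\<theta> - \<Theta>)))"
proof -
  have "density uniform_angle (\<lambda>\<theta>. ennreal (vm_ratio \<kappa> (\<theta> - \<Theta>))) =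
        density angles (\<lambda>\<theta>. ennreal (1/(2*pi)) * ennreal (vm_ratio \<kappa> (\<theta> - \<Theta>)))"
    unfolding uniform_angle_density
    by (intro density_density_eq) (auto simp: angles_def intro!: measurable_restrict_space1)
  also have "\<dots> = vonMises \<Theta> \<kappa>"
    unfolding vonMises_def
    by (intro density_cong AE_I2)
       (auto simp: angles_def vm_ratio_def bessel_I0_pos less_imp_le simp flip: ennreal_mult'' intro!: measurable_restrict_space1)
  finally show ?thesis ..
qed

section \<open>The correlation of two von Mises likelihood ratios\<close>

text \<open>
  The mean under the uniform law of the product of the likelihood ratios with phases \<open>s\<close> and \<open>t\<close>.
  Each index that lies in both of two planted subsets contributes one such factor to the second moment.
\<close>

definition vm_overlap :: "real \<Rightarrow> real \<Rightarrow> real \<Rightarrow> real" where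
  "vm_overlap \<kappa> s t = (\<integral>u. vm_ratio \<kappa> (u - s) * vm_ratio \<kappa> (u - t) \<partial>uniform_angle)"

text \<open>
  The diagonal value of \<^const>\<open>vm_overlap\<close>, which does not depend on the common phase and equals
  \<open>bessel_I0 (2 * \<kappa>) / (bessel_I0 \<kappa>)\<^sup>2\<close>.
\<close>

definition vm_peak :: "real \<Rightarrow> real" where
  "vm_peak \<kappa> = (\<integral>u. (vm_ratio \<kappa> u)\<^sup>2 \<partial>uniform_angle)"

lemma vm_overlap_nonneg: "0 \<le> vm_overlap \<kappa> s t"
  unfolding vm_overlap_def by (intro Bochner_Integration.integral_nonneg) (simp add: vm_ratio_pos less_imp_le)

text \<open>
  By the inequality of arithmetic and geometric means the product is at most the average of the two squares,
  and rotation invariance gives both squares the same integral.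
\<close>

lemma vm_overlap_le_peak:
  assumes "s \<in> {0..2*pi}" "t \<in> {0..2*pi}"
  shows "vm_overlap \<kappa> s t \<le> vm_peak \<kappa>"
proof -
  have sq: "(\<integral>u. (vm_ratio \<kappa> (u - r))\<^sup>2 \<partial>uniform_angle) = vm_peak \<kappa>" if "r \<in> {0..2*pi}" for r
    unfolding vm_peak_def
    by (rule integral_uniform_angle_rotate[where h = "\<lambda>u. (vm_ratio \<kappa> u)\<^sup>2"])
       (use that in \<open>auto intro!: continuous_intros simp: vm_ratio_periodic\<close>)
  have i: "integrable uniform_angle (\<lambda>u. (vm_ratio \<kappa> (u - r))\<^sup>2)" for r
    by (intro integrable_uniform_angle continuous_intros)
  have "vm_overlap \<kappa> s t \<le> (\<integral>u. ((vm_ratio \<kappa> (u - s))\<^sup>2 + (vm_ratio \<kappa> (u - t))\<^sup>2) / 2 \<partial>uniform_angle)"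
    unfolding vm_overlap_def
  proof (intro integral_mono integrable_uniform_angle continuous_intros)
    fix u
    show "vm_ratio \<kappa> (u - s) * vm_ratio \<kappa> (u - t) \<le> ((vm_ratio \<kappa> (u - s))\<^sup>2 + (vm_ratio \<kappa> (u - t))\<^sup>2) / 2"
      using sum_squares_bound[of "vm_ratio \<kappa> (u - s)" "vm_ratio \<kappa> (u - t)"] by simp
  qed auto
  also have "\<dots> = vm_peak \<kappa>"
    using assms by (simp add: i sq)
  finally show ?thesis .
qed

lemma vm_overlap_measurable [measurable]:
  "(\<lambda>(s,t). vm_overlap \<kappa> s t) \<in> borel_measurable (borel \<Otimes>\<^sub>M borel)"
proof -
  interpret prob_space uniform_angle by (rule prob_space_uniform_angle)
  show ?thesis unfolding vm_overlap_def by measurable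
qed

lemma vm_ratio_prod_bound:
  assumes "\<kappa> > 0"
  shows "norm (vm_ratio \<kappa> x * vm_ratio \<kappa> y) \<le> (exp \<kappa> / bessel_I0 \<kappa>)\<^sup>2"
  unfolding power2_eq_square norm_mult
  using vm_ratio_le[OF assms] vm_ratio_pos[of \<kappa>] bessel_I0_pos[of \<kappa>]
  by (intro mult_mono) (auto simp: less_imp_le)

text \<open>
  Integrating the phase \<open>t\<close> first turns the factor \<open>vm_ratio \<kappa> (u - t)\<close> into the constant 1,
  because the cosine is even and so the ratio has mean 1 in its phase as well as in the angle.
\<close>

lemma vm_overlap_mean:
  assumes "\<kappa> > 0" "s \<in> {0..2*pi}"
  shows "(\<integral>t. vm_overlap \<kappa> s t \<partial>uniform_angle) = 1"
proof -
  interpret prob_space uniform_angle by (rule prob_space_uniform_angle)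
  interpret P: pair_prob_space uniform_angle uniform_angle ..
  have "(\<integral>t. vm_overlap \<kappa> s t \<partial>uniform_angle) =
        (\<integral>u. (\<integral>t. vm_ratio \<kappa> (u - s) * vm_ratio \<kappa> (u - t) \<partial>uniform_angle) \<partial>uniform_angle)"
    unfolding vm_overlap_def
    by (intro P.Fubini_integral P.integrable_const_bound[where B = "(exp \<kappa> / bessel_I0 \<kappa>)\<^sup>2"])
       (use vm_ratio_prod_bound[OF assms(1)] in auto)
  also have "\<dots> = (\<integral>u. vm_ratio \<kappa> (u - s) * 1 \<partial>uniform_angle)"
  proof (intro Bochner_Integration.integral_cong refl)
    fix u assume "u \<in> space uniform_angle"
    hence "(\<integral>t. vm_ratio \<kappa> (u - t) \<partial>uniform_angle) = 1"
      using integral_vm_ratio[of u \<kappa>] by (simp add: vm_ratio_def cos_diff mult.commute)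
    thus "(\<integral>t. vm_ratio \<kappa> (u - s) * vm_ratio \<kappa> (u - t) \<partial>uniform_angle) = vm_ratio \<kappa> (u - s) * 1"
      by simp
  qed
  also have "\<dots> = 1" using integral_vm_ratio[OF assms(2)] by simp
  finally show ?thesis .
qed

lemma one_minus_cos_le: "1 - cos x \<le> x\<^sup>2 / 2" for x :: real
proof -
  have "1 - cos x = 2 * (sin (x/2))\<^sup>2"
    using cos_double_sin[of "x/2"] by simp
  also have "(sin (x/2))\<^sup>2 \<le> (x/2)\<^sup>2"
    using abs_sin_le_one abs_sin_x_le_abs_x[of "x/2"] by (metis abs_ge_zero power2_abs power_mono)
  finally show ?thesis by (simp add: power_divide)
qed

text \<open>
  The exponent of the product is \<open>\<kappa> * (cos (u - s) + cos (u - t)) = 2 * \<kappa> * cos d * cos (u - m)\<close> with \<open>m\<close> the midpoint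
  and \<open>d\<close> half the difference of the phases. Replacing \<open>cos d\<close> by 1 costs at most \<open>2 * \<kappa> * (1 - cos d) \<le> \<kappa> * d\<^sup>2\<close>,
  and what remains is the square of the ratio centred at \<open>m\<close>, whose integral is the peak.
\<close>

lemma vm_overlap_ge:
  assumes "\<kappa> > 0" "s \<in> {0..2*pi}" "t \<in> {0..2*pi}"
  shows "vm_peak \<kappa> * exp (- \<kappa> * (s - t)\<^sup>2 / 4) \<le> vm_overlap \<kappa> s t"
proof -
  define m where "m = (s + t) / 2"
  define d where "d = (s - t) / 2"
  have m: "m \<in> {0..2*pi}" using assms by (auto simp: m_def)
  have "vm_peak \<kappa> * exp (- \<kappa> * (s - t)\<^sup>2 / 4) =
        (\<integral>u. (vm_ratio \<kappa> (u - m))\<^sup>2 * exp (- \<kappa> * (s - t)\<^sup>2 / 4) \<partial>uniform_angle)"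
    unfolding vm_peak_def
    by (subst integral_uniform_angle_rotate[where h = "\<lambda>u. (vm_ratio \<kappa> u)\<^sup>2", OF _ _ m, symmetric])
       (auto intro!: continuous_intros simp: vm_ratio_periodic)
  also have "\<dots> \<le> vm_overlap \<kappa> s t"
    unfolding vm_overlap_def
  proof (intro integral_mono integrable_uniform_angle continuous_intros)
    fix u
    have "cos (u - s) + cos (u - t) = 2 * cos (u - m) * cos d"
      using cos_plus_cos[of "u - s" "u - t"]
      by (simp add: m_def d_def field_simps) (metis cos_minus minus_diff_eq minus_divide_left)
    also have "\<dots> \<ge> 2 * cos (u - m) - 2 * (1 - cos d)"
      using mult_left_mono[of "cos (u - m)" 1 "1 - cos d"] by (simp add: algebra_simps)
    finally have "cos (u - s) + cos (u - t) \<ge> 2 * cos (u - m) - d\<^sup>2"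
      using one_minus_cos_le[of d] by (smt (verit) field_sum_of_halves)
    hence "\<kappa> * (2 * cos (u - m) - d\<^sup>2) \<le> \<kappa> * (cos (u - s) + cos (u - t))"
      using assms by (intro mult_left_mono) auto
    hence "exp (\<kappa> * cos (u - m)) * exp (\<kappa> * cos (u - m)) * exp (- \<kappa> * (s - t)\<^sup>2 / 4)
           \<le> exp (\<kappa> * cos (u - s)) * exp (\<kappa> * cos (u - t))"
      by (simp add: d_def power_divide algebra_simps flip: exp_add)
    thus "(vm_ratio \<kappa> (u - m))\<^sup>2 * exp (- \<kappa> * (s - t)\<^sup>2 / 4) \<le> vm_ratio \<kappa> (u - s) * vm_ratio \<kappa> (u - t)"
      using bessel_I0_pos[of \<kappa>] by (simp add: vm_ratio_def power2_eq_square divide_right_mono)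
  qed
  finally show ?thesis .
qed

lemma vm_peak_nonneg: "0 \<le> vm_peak \<kappa>"
  unfolding vm_peak_def by simp

text \<open>
  The correlation with the phase \<open>pi\<close> has mean 1 but is, by the previous bound, at least the peak times a Gaussian
  bump of width of order \<open>1 / sqrt \<kappa>\<close>; hence the peak is at most of order \<open>sqrt \<kappa>\<close>. Bounding the bump below by the parabola \<open>1 - \<kappa> * (pi - t)\<^sup>2 / 4\<close> on the interval where it is nonnegative
  gives the constant \<open>3 / 4 * pi\<close> in front of \<open>sqrt \<kappa>\<close>, below the required \<open>2 * sqrt pi\<close>; the sharp
  asymptotic constant would be \<open>sqrt pi\<close>. The phase \<open>pi\<close> is chosen so that this interval lies inside \<open>{0..2*pi}\<close>.
\<close>

lemma vm_peak_le:
  assumes "\<kappa> > 0" "2 / sqrt \<kappa> \<le> pi"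
  shows "vm_peak \<kappa> \<le> 2 * sqrt (pi * \<kappa>)"
proof -
  interpret prob_space uniform_angle by (rule prob_space_uniform_angle)
  \<comment> \<open>The zeros of the parabola are at distance \<open>a\<close> from \<open>pi\<close>.\<close>
  define a where "a = 2 / sqrt \<kappa>"
  have a: "0 < a" "a \<le> pi" "\<kappa> * a\<^sup>2 = 4" "a\<^sup>2 = 4 / \<kappa>" using assms by (auto simp: a_def power_divide)
  define q where "q = (\<lambda>t::real. 1 - \<kappa> * (pi - t)\<^sup>2 / 4)"
  have qc: "continuous_on A q" for A unfolding q_def by (intro continuous_intros) auto
  have [measurable]: "q \<in> borel_measurable borel" by (intro borel_measurable_continuous_onI qc)
  have qn: "max 0 (q t) \<le> exp (- \<kappa> * (pi - t)\<^sup>2 / 4)" for t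
    using exp_ge_add_one_self[of "- \<kappa> * (pi - t)\<^sup>2 / 4"] by (auto simp: q_def)
  define F where "F = (\<lambda>t::real. t + \<kappa> * (pi - t)^3 / 12)"
  have "(q has_integral F (pi + a) - F (pi - a)) {pi - a..pi + a}"
    using a by (intro fundamental_theorem_of_calculus)
      (auto simp: F_def q_def power2_eq_square simp flip: has_real_derivative_iff_has_vector_derivative intro!: derivative_eq_intros)
  also have "F (pi + a) - F (pi - a) = 2 * a - \<kappa> * a\<^sup>2 * a / 6"
    by (simp add: F_def field_simps power2_eq_square power3_eq_cube)
  also have "\<dots> = 4/3 * a" by (simp add: a(3))
  finally have I: "(q has_integral 4/3 * a) {pi - a..pi + a}" .
  have "4/3 * a = integral {pi - a..pi + a} q" using I by (simp add: integral_unique)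
  also have "\<dots> \<le> integral {pi - a..pi + a} (\<lambda>t. max 0 (q t))"
    by (intro integral_le integrable_continuous_real continuous_intros qc) auto
  also have "\<dots> \<le> integral {0..2*pi} (\<lambda>t. max 0 (q t))"
    using a by (intro integral_subset_le integrable_continuous_real continuous_intros qc) auto
  also have "\<dots> \<le> integral {0..2*pi} (\<lambda>t. exp (- \<kappa> * (pi - t)\<^sup>2 / 4))"
    using qn by (intro integral_le integrable_continuous_real continuous_intros qc) auto
  finally have "4/3 * a / (2*pi) \<le> integral {0..2*pi} (\<lambda>t. exp (- \<kappa> * (pi - t)\<^sup>2 / 4)) / (2*pi)"
    by (rule divide_right_mono) simp
  also have "\<dots> = (\<integral>t. exp (- \<kappa> * (pi - t)\<^sup>2 / 4) \<partial>uniform_angle)"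
    by (intro integral_uniform_angle[symmetric] continuous_intros) auto
  finally have "vm_peak \<kappa> * (4/3 * a / (2*pi)) \<le> vm_peak \<kappa> * (\<integral>t. exp (- \<kappa> * (pi - t)\<^sup>2 / 4) \<partial>uniform_angle)"
    by (intro mult_left_mono vm_peak_nonneg)
  also have "\<dots> = (\<integral>t. vm_peak \<kappa> * exp (- \<kappa> * (pi - t)\<^sup>2 / 4) \<partial>uniform_angle)" by simp
  also have "\<dots> \<le> (\<integral>t. vm_overlap \<kappa> pi t \<partial>uniform_angle)"
  proof (rule integral_mono)
    show "integrable uniform_angle (\<lambda>t. vm_peak \<kappa> * exp (- \<kappa> * (pi - t)\<^sup>2 / 4))"
      by (intro integrable_uniform_angle continuous_intros) auto
    show "integrable uniform_angle (vm_overlap \<kappa> pi)"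
      using vm_overlap_le_peak[of pi _ \<kappa>] vm_overlap_nonneg[of \<kappa> pi]
      by (intro integrable_const_bound[where B = "vm_peak \<kappa>"]) auto
  qed (use vm_overlap_ge[of \<kappa> pi] assms in auto)
  also have "\<dots> = 1" using assms by (intro vm_overlap_mean) auto
  finally have "vm_peak \<kappa> \<le> 3 * pi / (2 * a)"
    using a by (simp add: field_simps)
  also have "\<dots> = 3 / 4 * pi * sqrt \<kappa>" using assms by (simp add: a_def)
  also have "\<dots> = 3 / 4 * sqrt pi * sqrt (pi * \<kappa>)" by (simp add: real_sqrt_mult)
  also have "\<dots> \<le> 3 / 4 * 2 * sqrt (pi * \<kappa>)"
    using pi_less_4 assms by (intro mult_right_mono mult_left_mono real_le_lsqrt) auto
  also have "\<dots> \<le> 2 * sqrt (pi * \<kappa>)" using assms by simp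
  finally show ?thesis .
qed

text \<open>
  For \<open>m > 0\<close>, bound \<open>m - 1\<close> of the factors by \<open>B\<close> and integrate the last one exactly, which gives \<open>B ^ (m - 1)\<close>: averaging
  over the phase gains a factor \<open>1 / B\<close> over the trivial bound. The summand 1 covers \<open>m = 0\<close>.
\<close>

lemma vm_overlap_moment:
  assumes "\<kappa> > 0" "2 / sqrt \<kappa> \<le> pi" and B: "B = 2 * sqrt (pi * \<kappa>)"
  shows "(\<integral>s. \<integral>t. vm_overlap \<kappa> s t ^ m \<partial>uniform_angle \<partial>uniform_angle) \<le> 1 + B ^ m / B"
proof -
  interpret prob_space uniform_angle by (rule prob_space_uniform_angle)
  have B0: "B > 0" using assms by simp
  have le: "vm_overlap \<kappa> s t \<le> B" if "s \<in> {0..<2*pi}" "t \<in> {0..<2*pi}" for s t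
    using vm_overlap_le_peak[of s t \<kappa>] vm_peak_le[OF assms(1,2)] that by (auto simp: B)
  have mp: "vm_overlap \<kappa> s t ^ m \<le> B ^ m" if "s \<in> {0..<2*pi}" "t \<in> {0..<2*pi}" for s t
    using le[OF that] by (intro power_mono vm_overlap_nonneg)
  have i: "integrable uniform_angle (\<lambda>t. vm_overlap \<kappa> s t ^ m)" if "s \<in> {0..<2*pi}" for s
    by (rule integrable_const_bound[where B = "B ^ m"])
       (use that mp vm_overlap_nonneg in \<open>auto intro!: AE_I2\<close>)
  have i1: "integrable uniform_angle (\<lambda>t. vm_overlap \<kappa> s t)" if "s \<in> {0..<2*pi}" for s
    by (rule integrable_const_bound[where B = "B"])
       (use that le vm_overlap_nonneg in \<open>auto intro!: AE_I2\<close>)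
  have *: "(\<integral>t. vm_overlap \<kappa> s t ^ m \<partial>uniform_angle) \<le> 1 + B ^ m / B" if s: "s \<in> {0..<2*pi}" for s
  proof (cases m)
    case 0 thus ?thesis using B0 by (simp add: prob_space)
  next
    case (Suc k)
    have "(\<integral>t. vm_overlap \<kappa> s t ^ m \<partial>uniform_angle) \<le> (\<integral>t. B ^ k * vm_overlap \<kappa> s t \<partial>uniform_angle)"
    proof (intro integral_mono i[OF s] integrable_mult_right i1[OF s])
      fix t assume t: "t \<in> space uniform_angle"
      thus "vm_overlap \<kappa> s t ^ m \<le> B ^ k * vm_overlap \<kappa> s t"
        unfolding Suc power_Suc2 using le[OF s]
        by (intro mult_right_mono power_mono vm_overlap_nonneg) auto
    qed
    also have "\<dots> = B ^ k" using vm_overlap_mean[OF assms(1), of s] s by simp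
    also have "\<dots> \<le> 1 + B ^ m / B" using B0 by (simp add: Suc)
    finally show ?thesis .
  qed
  have "(\<integral>s. \<integral>t. vm_overlap \<kappa> s t ^ m \<partial>uniform_angle \<partial>uniform_angle) \<le> (\<integral>s. 1 + B ^ m / B \<partial>uniform_angle)"
  proof (rule integral_mono)
    show "integrable uniform_angle (\<lambda>s. \<integral>t. vm_overlap \<kappa> s t ^ m \<partial>uniform_angle)"
    proof (rule integrable_const_bound[where B = "1 + B ^ m / B"])
      show "AE s in uniform_angle. norm (\<integral>t. vm_overlap \<kappa> s t ^ m \<partial>uniform_angle) \<le> 1 + B ^ m / B"
        using * by (auto intro!: AE_I2 simp: vm_overlap_nonneg Bochner_Integration.integral_nonneg)
    qed measurable
  qed (use * in auto)
  thus ?thesis by (simp add: prob_space)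
qed

section \<open>The overlap of two subsets of equal size\<close>

text \<open>
  The probability that a uniform \<open>K\<close>-subset of \<open>N\<close> points contains \<open>j\<close> given ones is at most \<open>(K / N) ^ j\<close>:
  it is the product of the factors \<open>(K - i) / (N - i)\<close> for \<open>i < j\<close>, each at most \<open>K / N\<close>. The statement is cleared of denominators.
\<close>

lemma binomial_diff_le:
  assumes "K \<le> N" "j \<le> K"
  shows "real ((N - j) choose (K - j)) * real N ^ j \<le> real K ^ j * real (N choose K)"
  using assms(2)
proof (induction j)
  case (Suc j)
  have "(K - j) * ((N - j) choose (K - j)) = (N - j) * ((N - Suc j) choose (K - Suc j))"
    using times_binomial_minus1_eq[of "K - j" "N - j"] Suc.prems by simp
  hence e: "real (K - j) * real ((N - j) choose (K - j)) = real (N - j) * real ((N - Suc j) choose (K - Suc j))"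
    by (metis of_nat_mult)
  have "K * (N - j) \<ge> N * (K - j)"
    using assms(1) by (simp add: diff_mult_distrib2 mult.commute diff_le_mono2)
  hence kn: "real N * real (K - j) \<le> real K * real (N - j)" by (metis of_nat_le_iff of_nat_mult)
  have "real (N - j) * (real ((N - Suc j) choose (K - Suc j)) * real N ^ Suc j)
        = (real N * real (K - j)) * (real ((N - j) choose (K - j)) * real N ^ j)"
    using e by (simp add: algebra_simps)
  also have "\<dots> \<le> (real K * real (N - j)) * (real K ^ j * real (N choose K))"
    using Suc by (intro mult_mono[OF kn]) auto
  also have "\<dots> = real (N - j) * (real K ^ Suc j * real (N choose K))" by simp
  finally show ?case using Suc.prems assms(1) by simp
qed simp

lemma card_supersets:
  assumes "finite A" "J \<subseteq> A" "card J \<le> K"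
  shows "card {T. T \<subseteq> A \<and> card T = K \<and> J \<subseteq> T} = (card A - card J) choose (K - card J)"
proof -
  have fJ: "finite J" using assms finite_subset by blast
  have "bij_betw (\<lambda>T. T - J) {T. T \<subseteq> A \<and> card T = K \<and> J \<subseteq> T} {U. U \<subseteq> A - J \<and> card U = K - card J}"
  proof (rule bij_betw_byWitness[where f' = "\<lambda>U. U \<union> J"])
    show "(\<lambda>U. U \<union> J) ` {U. U \<subseteq> A - J \<and> card U = K - card J} \<subseteq> {T. T \<subseteq> A \<and> card T = K \<and> J \<subseteq> T}"
    proof safe
      fix U assume U: "U \<subseteq> A - J" "card U = K - card J"
      have "card (U \<union> J) = card U + card J"
        using U fJ assms(1) by (intro card_Un_disjoint) (auto intro: finite_subset)
      thus "card (U \<union> J) = K" using U assms by simp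
    qed (use assms in auto)
  qed (use fJ in \<open>auto simp: card_Diff_subset\<close>)
  hence "card {T. T \<subseteq> A \<and> card T = K \<and> J \<subseteq> T} = card {U. U \<subseteq> A - J \<and> card U = K - card J}"
    by (rule bij_betw_same_card)
  also have "\<dots> = (card (A - J)) choose (K - card J)"
    using assms by (intro n_subsets) auto
  finally show ?thesis using assms fJ by (simp add: card_Diff_subset)
qed

text \<open>
  Bound \<open>B ^ card (S \<inter> T)\<close> by the sum of \<open>B ^ card J\<close> over all subsets \<open>J\<close> of \<open>S \<inter> T\<close> and exchange the sums. The sum over \<open>T\<close> then
  counts the supersets of \<open>J\<close>, and the remaining sum over the subsets of \<open>S\<close> is the binomial
  expansion of \<open>(1 + B * K / N) ^ K\<close>.
\<close>

lemma overlap_mgf: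
  fixes B :: real
  assumes B: "B \<ge> 0" and S: "S \<subseteq> {..<N}" "card S = K" and "N > 0"
  shows "(\<Sum>T | T \<subseteq> {..<N} \<and> card T = K. B ^ card (S \<inter> T)) \<le> real (N choose K) * exp (B * (real K)\<^sup>2 / real N)"
proof -
  have fS: "finite S" using S finite_subset by blast
  have KN: "K \<le> N" using S card_mono[of "{..<N}" S] by simp
  let ?F = "{T. T \<subseteq> {..<N} \<and> card T = K}"
  have "(\<Sum>T\<in>?F. B ^ card (S \<inter> T)) \<le> (\<Sum>T\<in>?F. \<Sum>J\<in>Pow S. if J \<subseteq> T then B ^ card J else 0)"
  proof (rule sum_mono)
    fix T
    have "B ^ card (S \<inter> T) = (\<Sum>J\<in>{S \<inter> T}. if J \<subseteq> T then B ^ card J else 0)" by simp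
    also have "\<dots> \<le> (\<Sum>J\<in>Pow S. if J \<subseteq> T then B ^ card J else 0)"
      using fS B by (intro sum_mono2) auto
    finally show "B ^ card (S \<inter> T) \<le> \<dots>" .
  qed
  also have "\<dots> = (\<Sum>J\<in>Pow S. \<Sum>T\<in>?F. if J \<subseteq> T then B ^ card J else 0)" by (rule sum.swap)
  also have "\<dots> \<le> (\<Sum>J\<in>Pow S. real (N choose K) * (B * real K / real N) ^ card J)"
  proof (rule sum_mono)
    fix J assume J: "J \<in> Pow S"
    hence cJ: "card J \<le> K" using S fS card_mono by blast
    have "(\<Sum>T\<in>?F. if J \<subseteq> T then B ^ card J else 0) = (\<Sum>T | T \<subseteq> {..<N} \<and> card T = K \<and> J \<subseteq> T. B ^ card J)"
      by (rule sum.mono_neutral_cong_right) auto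
    also have "\<dots> = real ((N - card J) choose (K - card J)) * B ^ card J"
      using card_supersets[of "{..<N}" J K] J S cJ by auto
    also have "\<dots> \<le> real (N choose K) * (real K / real N) ^ card J * B ^ card J"
      using binomial_diff_le[OF KN cJ] B \<open>N > 0\<close>
      by (intro mult_right_mono) (auto simp: field_simps)
    finally show "(\<Sum>T\<in>?F. if J \<subseteq> T then B ^ card J else 0) \<le> real (N choose K) * (B * real K / real N) ^ card J"
      by (simp add: power_mult_distrib power_divide mult_ac)
  qed
  also have "\<dots> = real (N choose K) * (\<Sum>J\<in>Pow S. (B * real K / real N) ^ card J)"
    by (simp add: sum_distrib_left)
  also have "(\<Sum>J\<in>Pow S. (B * real K / real N) ^ card J) = (B * real K / real N + 1) ^ K"
    using prod_add[OF fS, of "\<lambda>_. B * real K / real N" "\<lambda>_. 1"] S by simp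
  also have "\<dots> \<le> exp (B * real K / real N) ^ K"
    using B by (intro power_mono) (auto simp: exp_ge_add_one_self add.commute)
  also have "\<dots> = exp (B * (real K)\<^sup>2 / real N)"
    by (simp add: power2_eq_square mult_ac flip: exp_of_nat_mult)
  finally show ?thesis by (simp add: mult_left_mono)
qed

section \<open>The second moment bound for mixtures\<close>

text \<open>
  Let \<open>L\<close> be the likelihood ratio of the mixture, the average of \<open>g t\<close> over the prior \<open>T\<close>. The left-hand side is the
  \<open>Q\<close>-mean of \<open>(L - 1) * indicator A\<close>, which is at most the root of its second moment and so at most the root of
  the mean of \<open>(L - 1)\<^sup>2\<close>. As \<open>L\<close> has mean 1, the latter is the mean of \<open>L\<^sup>2\<close> minus 1, and writing \<open>L\<^sup>2\<close> as a
  double average over independent copies of the parameter gives the right-hand side. Boundedness of \<open>g\<close>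
  justifies the exchanges of integrals.
\<close>

lemma mixture_discrepancy_le:
  fixes g :: "'t \<Rightarrow> 'x \<Rightarrow> real"
  assumes T: "prob_space T" and Q: "prob_space Q"
    and g: "(\<lambda>(t, x). g t x) \<in> borel_measurable (T \<Otimes>\<^sub>M Q)"
    and bound: "\<And>t x. t \<in> space T \<Longrightarrow> x \<in> space Q \<Longrightarrow> \<bar>g t x\<bar> \<le> C"
    and mean: "\<And>t. t \<in> space T \<Longrightarrow> (\<integral>x. g t x \<partial>Q) = 1"
    and A: "A \<in> sets Q"
  shows "(\<integral>t. \<integral>x. g t x * indicator A x \<partial>Q \<partial>T) - measure Q A
         \<le> sqrt ((\<integral>s. \<integral>t. \<integral>x. g s x * g t x \<partial>Q \<partial>T \<partial>T) - 1)"
proof -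
  interpret T: prob_space T by fact
  interpret Q: prob_space Q by fact
  interpret P: pair_prob_space T Q ..
  note [measurable] = g A
  define L where "L = (\<lambda>x. \<integral>t. g t x \<partial>T)"
  have [measurable]: "L \<in> borel_measurable Q" unfolding L_def by measurable
  have am: "\<bar>a * b\<bar> \<le> C' * D" if "\<bar>a\<bar> \<le> C'" "\<bar>b\<bar> \<le> D" for a b C' D :: real
    unfolding abs_mult using that by (intro mult_mono) auto
  obtain t0 x0 where "t0 \<in> space T" "x0 \<in> space Q" using T.not_empty Q.not_empty by blast
  hence C: "C \<ge> 0" using bound[of t0 x0] by simp
  have Lb: "\<bar>L x\<bar> \<le> C" if "x \<in> space Q" for x
  proof -
    have "\<bar>L x\<bar> \<le> (\<integral>t. \<bar>g t x\<bar> \<partial>T)" unfolding L_def by (rule integral_abs_bound)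
    also have "\<dots> \<le> (\<integral>t. C \<partial>T)"
      using bound that C by (intro integral_mono T.integrable_const_bound[where B = C] AE_I2) auto
    finally show ?thesis by (simp add: T.prob_space)
  qed
  have swap: "(\<integral>x. L x * f x \<partial>Q) = (\<integral>t. \<integral>x. g t x * f x \<partial>Q \<partial>T)"
    if [measurable]: "f \<in> borel_measurable Q" and f: "\<And>x. x \<in> space Q \<Longrightarrow> \<bar>f x\<bar> \<le> D" for f D
  proof -
    have "(\<integral>x. L x * f x \<partial>Q) = (\<integral>x. \<integral>t. g t x * f x \<partial>T \<partial>Q)" by (simp add: L_def)
    also have "\<dots> = (\<integral>t. \<integral>x. g t x * f x \<partial>Q \<partial>T)"
      using bound f C
      by (intro P.Fubini_integral P.integrable_const_bound[where B = "C * D"] AE_I2)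
         (auto simp: space_pair_measure intro!: am)
    finally show ?thesis .
  qed
  have Lint: "integrable Q L"
    using Lb by (intro Q.integrable_const_bound[where B = C] AE_I2) auto
  have L2int: "integrable Q (\<lambda>x. L x * L x)"
    by (intro Q.integrable_const_bound[where B = "C * C"] AE_I2) (use am Lb in \<open>simp_all only: real_norm_def\<close>, measurable)
  have L1: "(\<integral>x. L x \<partial>Q) = 1"
    proof -
    have "(\<integral>x. L x \<partial>Q) = (\<integral>t. \<integral>x. g t x \<partial>Q \<partial>T)"
      using swap[of "\<lambda>_. 1" 1] by simp
    also have "\<dots> = (\<integral>t. 1 \<partial>T)" by (intro Bochner_Integration.integral_cong refl mean)
    finally show ?thesis by (simp add: T.prob_space)
  qed
  have inner: "(\<integral>x. g s x * L x \<partial>Q) = (\<integral>t. \<integral>x. g s x * g t x \<partial>Q \<partial>T)" if s: "s \<in> space T" for s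
  proof -
    have [measurable]: "g s \<in> borel_measurable Q" using measurable_Pair2[OF g s] by simp
    have "(\<integral>x. g s x * L x \<partial>Q) = (\<integral>x. L x * g s x \<partial>Q)" by (simp add: mult.commute)
    also have "\<dots> = (\<integral>t. \<integral>x. g t x * g s x \<partial>Q \<partial>T)"
      by (rule swap[of "g s" C]) (use bound s in auto)
    finally show ?thesis by (simp add: mult.commute)
  qed
  have L2: "(\<integral>x. L x * L x \<partial>Q) = (\<integral>s. \<integral>t. \<integral>x. g s x * g t x \<partial>Q \<partial>T \<partial>T)"
    proof -
    have "(\<integral>x. L x * L x \<partial>Q) = (\<integral>s. \<integral>x. g s x * L x \<partial>Q \<partial>T)"
      by (rule swap[of L C]) (use Lb in auto)
    also have "\<dots> = (\<integral>s. \<integral>t. \<integral>x. g s x * g t x \<partial>Q \<partial>T \<partial>T)"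
      by (intro Bochner_Integration.integral_cong refl inner)
    finally show ?thesis .
  qed
  define Y where "Y = (\<lambda>x. (L x - 1) * indicator A x :: real)"
  have [measurable]: "Y \<in> borel_measurable Q" unfolding Y_def by measurable
  have Yb: "\<bar>Y x\<bar> \<le> C + 1" if "x \<in> space Q" for x
    using Lb[OF that] by (auto simp: Y_def indicator_def)
  have Yint: "integrable Q Y"
    using Yb by (intro Q.integrable_const_bound[where B = "C + 1"] AE_I2) auto
  have Y2int: "integrable Q (\<lambda>x. (Y x)\<^sup>2)"
    using Yb by (intro Q.integrable_const_bound[where B = "(C + 1)\<^sup>2"] AE_I2)
      (auto simp: abs_le_square_iff[symmetric] C)
  have "(\<integral>t. \<integral>x. g t x * indicator A x \<partial>Q \<partial>T) - measure Q A = (\<integral>x. Y x \<partial>Q)"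
  proof -
    have "integrable Q (\<lambda>x. L x * indicator A x)"
      by (rule integrable_real_mult_indicator) (auto simp: Lint)
    moreover have "integrable Q (indicator A :: _ \<Rightarrow> real)"
      by (simp add: Q.emeasure_eq_measure)
    ultimately have "(\<integral>x. Y x \<partial>Q) = (\<integral>x. L x * indicator A x \<partial>Q) - measure Q A"
      by (simp add: Y_def left_diff_distrib Bochner_Integration.integral_diff)
    also have "(\<integral>x. L x * indicator A x \<partial>Q) = (\<integral>t. \<integral>x. g t x * indicator A x \<partial>Q \<partial>T)"
      by (rule swap[of _ 1]) (auto simp: indicator_def)
    finally show ?thesis by simp
  qed
  also have "\<dots> \<le> sqrt (\<integral>x. (Y x)\<^sup>2 \<partial>Q)"
  proof (rule real_le_rsqrt)
    have "0 \<le> Q.variance Y" by (rule Q.variance_positive)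
    thus "(\<integral>x. Y x \<partial>Q)\<^sup>2 \<le> (\<integral>x. (Y x)\<^sup>2 \<partial>Q)" using Q.variance_eq[OF Yint Y2int] by simp
  qed
  also have "(\<integral>x. (Y x)\<^sup>2 \<partial>Q) \<le> (\<integral>x. L x * L x - 2 * L x + 1 \<partial>Q)"
  proof (rule integral_mono[OF Y2int])
    fix x
    have "(Y x)\<^sup>2 \<le> (L x - 1)\<^sup>2" by (simp add: Y_def indicator_def)
    thus "(Y x)\<^sup>2 \<le> L x * L x - 2 * L x + 1" by (simp add: power2_eq_square algebra_simps)
  qed (simp add: L2int Lint)
  also have "(\<integral>x. L x * L x - 2 * L x + 1 \<partial>Q) = (\<integral>x. L x * L x \<partial>Q) - 1"
    by (simp add: L2int Lint L1 Q.prob_space)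
  finally show ?thesis by (simp add: L2)
qed

text \<open>
  Both sides agree on boxes, where the integral of the product density factorises.
\<close>

lemma PiM_density:
  fixes f :: "'i \<Rightarrow> 'a \<Rightarrow> ennreal"
  assumes "finite I" and M: "prob_space M"
    and f: "\<And>i. i \<in> I \<Longrightarrow> f i \<in> borel_measurable M"
    and D: "\<And>i. prob_space (D i)" "\<And>i. i \<in> I \<Longrightarrow> D i = density M (f i)"
  shows "PiM I D = density (PiM I (\<lambda>_. M)) (\<lambda>x. \<Prod>i\<in>I. f i (x i))"
proof -
  interpret M: product_prob_space "\<lambda>_. M" by (rule product_prob_spaceI) (rule M)
  interpret D: product_prob_space D by (rule product_prob_spaceI) (rule D)
  note [measurable] = f
  have s: "sets (PiM I D) = sets (PiM I (\<lambda>_. M))"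
    by (rule sets_PiM_cong) (auto simp: D)
  show ?thesis
  proof (rule D.PiM_eqI[symmetric, OF \<open>finite I\<close>])
    show "sets (density (PiM I (\<lambda>_. M)) (\<lambda>x. \<Prod>i\<in>I. f i (x i))) = sets (PiM I D)" using s by simp
    fix A assume A: "\<And>i. i \<in> I \<Longrightarrow> A i \<in> sets (D i)"
    hence A': "\<And>i. i \<in> I \<Longrightarrow> A i \<in> sets M" by (simp add: D)
    have "Pi\<^sub>E I A \<in> sets (PiM I (\<lambda>_. M))" by (rule sets_PiM_I_finite) (use assms A' in auto)
    hence "emeasure (density (PiM I (\<lambda>_. M)) (\<lambda>x. \<Prod>i\<in>I. f i (x i))) (Pi\<^sub>E I A) =
       (\<integral>\<^sup>+x. (\<Prod>i\<in>I. f i (x i)) * indicator (Pi\<^sub>E I A) x \<partial>PiM I (\<lambda>_. M))"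
      by (subst emeasure_density) auto
    also have "\<dots> = (\<integral>\<^sup>+x. (\<Prod>i\<in>I. f i (x i) * indicator (A i) (x i)) \<partial>PiM I (\<lambda>_. M))"
    proof (intro nn_integral_cong)
      fix x assume x: "x \<in> space (PiM I (\<lambda>_. M))"
      show "(\<Prod>i\<in>I. f i (x i)) * indicator (Pi\<^sub>E I A) x = (\<Prod>i\<in>I. f i (x i) * indicator (A i) (x i))"
      proof (cases "x \<in> Pi\<^sub>E I A")
        case True thus ?thesis by (auto simp: indicator_def PiE_mem intro!: prod.cong)
      next
        case False
        then obtain i where "i \<in> I" "x i \<notin> A i" using x by (auto simp: space_PiM PiE_def)
        thus ?thesis using False \<open>finite I\<close> by (auto intro!: bexI[of _ i])
      qed
    qed
    also have "\<dots> = (\<Prod>i\<in>I. \<integral>\<^sup>+x. f i x * indicator (A i) x \<partial>M)"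
      using A' by (intro M.product_nn_integral_prod \<open>finite I\<close>) auto
    also have "\<dots> = (\<Prod>i\<in>I. emeasure (D i) (A i))"
      using A' by (intro prod.cong) (auto simp: D emeasure_density)
    finally show "emeasure (density (PiM I (\<lambda>_. M)) (\<lambda>x. \<Prod>i\<in>I. f i (x i))) (Pi\<^sub>E I A) = (\<Prod>i\<in>I. emeasure (D i) (A i))" .
  qed
qed

section \<open>The likelihood ratio of the flat model\<close>

lemma prob_space_vonMises:
  assumes "\<Theta> \<in> {0..2*pi}"
  shows "prob_space (vonMises \<Theta> \<kappa>)"
proof
  have "emeasure (vonMises \<Theta> \<kappa>) (space (vonMises \<Theta> \<kappa>)) =
        (\<integral>\<^sup>+u. ennreal (vm_ratio \<kappa> (u - \<Theta>)) \<partial>uniform_angle)"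
    unfolding vonMises_density
    by (subst emeasure_density) (auto intro!: nn_integral_cong sets.top[of uniform_angle, simplified])
  also have "\<dots> = ennreal (\<integral>u. vm_ratio \<kappa> (u - \<Theta>) \<partial>uniform_angle)"
    by (intro nn_integral_eq_integral integrable_uniform_angle continuous_intros)
       (auto simp: vm_ratio_pos less_imp_le)
  finally show "emeasure (vonMises \<Theta> \<kappa>) (space (vonMises \<Theta> \<kappa>)) = 1"
    using integral_vm_ratio[OF assms] by simp
qed

text \<open>
  The density of \<open>flat_conditional N \<kappa> S \<Theta>\<close> with respect to \<open>flat_null N\<close>.
\<close>

definition planted_ratio :: "nat \<Rightarrow> real \<Rightarrow> nat set \<Rightarrow> real \<Rightarrow> (nat \<Rightarrow> real) \<Rightarrow> real" where
  "planted_ratio N \<kappa> S \<Theta> x = (\<Prod>i<N. if i \<in> S then vm_ratio \<kappa> (x i - \<Theta>) else 1)"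

lemma planted_ratio_nonneg: "0 \<le> planted_ratio N \<kappa> S \<Theta> x"
  unfolding planted_ratio_def by (intro prod_nonneg) (simp add: vm_ratio_pos less_imp_le)

lemma planted_ratio_le:
  assumes "\<kappa> > 0"
  shows "planted_ratio N \<kappa> S \<Theta> x \<le> max 1 (exp \<kappa> / bessel_I0 \<kappa>) ^ N"
proof -
  have "planted_ratio N \<kappa> S \<Theta> x \<le> (\<Prod>i<N. max 1 (exp \<kappa> / bessel_I0 \<kappa>))"
    unfolding planted_ratio_def
    using vm_ratio_le[OF assms] vm_ratio_pos[of \<kappa>]
    by (intro prod_mono) (auto simp: less_imp_le le_max_iff_disj)
  thus ?thesis by simp
qed

lemma prob_space_flat_null: "prob_space (flat_null N)"
  unfolding flat_null_def by (intro prob_space_PiM prob_space_uniform_angle)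

lemma measurable_flat_null_component:
  assumes "i < N"
  shows "(\<lambda>x. x i) \<in> borel_measurable (flat_null N)"
  unfolding flat_null_def using assms
  by (intro measurable_uniform_angle measurable_component_singleton) auto

lemma measurable_planted_ratio:
  "(\<lambda>(\<Theta>, x). planted_ratio N \<kappa> S \<Theta> x) \<in> borel_measurable (uniform_angle \<Otimes>\<^sub>M flat_null N)"
proof -
  have [measurable]: "(\<lambda>p. snd p i - fst p) \<in> borel_measurable (uniform_angle \<Otimes>\<^sub>M flat_null N)" if "i < N" for i
  proof (rule borel_measurable_diff)
    show "(\<lambda>p. snd p i) \<in> borel_measurable (uniform_angle \<Otimes>\<^sub>M flat_null N)"
      by (rule measurable_compose[OF measurable_snd measurable_flat_null_component[OF that]])
    show "fst \<in> borel_measurable (uniform_angle \<Otimes>\<^sub>M flat_null N)"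
      by (intro measurable_uniform_angle measurable_fst)
  qed
  show ?thesis
    unfolding planted_ratio_def split_beta
  proof (rule borel_measurable_prod)
    fix i assume "i \<in> {..<N}"
    hence "i < N" by simp
    note [measurable] = this
    show "(\<lambda>p. if i \<in> S then vm_ratio \<kappa> (snd p i - fst p) else 1) \<in> borel_measurable (uniform_angle \<Otimes>\<^sub>M flat_null N)"
      by measurable
  qed
qed

lemma measurable_planted_ratio':
  "planted_ratio N \<kappa> S \<Theta> \<in> borel_measurable (flat_null N)"
  unfolding planted_ratio_def
proof (rule borel_measurable_prod)
  fix i assume "i \<in> {..<N}"
  hence [measurable]: "(\<lambda>x. x i) \<in> borel_measurable (flat_null N)"
    by (intro measurable_flat_null_component) auto
  show "(\<lambda>x. if i \<in> S then vm_ratio \<kappa> (x i - \<Theta>) else 1) \<in> borel_measurable (flat_null N)"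
    by measurable
qed

lemma flat_conditional_density:
  assumes "\<Theta> \<in> {0..2*pi}"
  shows "flat_conditional N \<kappa> S \<Theta> = density (flat_null N) (\<lambda>x. ennreal (planted_ratio N \<kappa> S \<Theta> x))"
proof -
  have "flat_conditional N \<kappa> S \<Theta> = density (flat_null N) (\<lambda>x. \<Prod>i<N. ennreal (if i \<in> S then vm_ratio \<kappa> (x i - \<Theta>) else 1))"
    unfolding flat_conditional_def flat_null_def
  proof (rule PiM_density[where f = "\<lambda>i u. ennreal (if i \<in> S then vm_ratio \<kappa> (u - \<Theta>) else 1)"])
    show "prob_space (if i \<in> S then vonMises \<Theta> \<kappa> else uniform_angle)" for i
      using assms by (simp add: prob_space_vonMises prob_space_uniform_angle)
    show "(if i \<in> S then vonMises \<Theta> \<kappa> else uniform_angle) =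
          density uniform_angle (\<lambda>u. ennreal (if i \<in> S then vm_ratio \<kappa> (u - \<Theta>) else 1))" for i
      by (simp add: vonMises_density density_1)
  qed (auto simp: prob_space_uniform_angle)
  thus ?thesis
    by (simp add: planted_ratio_def prod_ennreal vm_ratio_pos less_imp_le)
qed

lemma prob_space_flat_conditional:
  assumes "\<Theta> \<in> {0..2*pi}"
  shows "prob_space (flat_conditional N \<kappa> S \<Theta>)"
  unfolding flat_conditional_def
  using assms by (intro prob_space_PiM) (simp add: prob_space_vonMises prob_space_uniform_angle)

text \<open>
  Independence factorises the integral over the coordinates. An index outside \<open>S \<inter> T\<close> carries at most one likelihood
  ratio and contributes the factor 1.
\<close>

lemma integral_planted_ratio_prod:
  assumes st: "s \<in> {0..2*pi}" "t \<in> {0..2*pi}"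
  shows "(\<integral>x. planted_ratio N \<kappa> S s x * planted_ratio N \<kappa> T t x \<partial>flat_null N) =
    vm_overlap \<kappa> s t ^ card ({..<N} \<inter> (S \<inter> T))"
proof -
  interpret prob_space uniform_angle by (rule prob_space_uniform_angle)
  interpret P: product_prob_space "\<lambda>_::nat. uniform_angle"
    by (rule product_prob_spaceI) (rule prob_space_uniform_angle)
  have cont: "continuous_on UNIV (\<lambda>u. if i \<in> U then vm_ratio \<kappa> (u - r) else 1)" for i U r
    by (cases "i \<in> U") (auto intro!: continuous_intros)
  let ?f = "\<lambda>i u. (if i \<in> S then vm_ratio \<kappa> (u - s) else 1) * (if i \<in> T then vm_ratio \<kappa> (u - t) else 1)"
  have "(\<integral>x. planted_ratio N \<kappa> S s x * planted_ratio N \<kappa> T t x \<partial>flat_null N) =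
        (\<integral>x. (\<Prod>i<N. ?f i (x i)) \<partial>flat_null N)"
    by (simp add: planted_ratio_def prod.distrib)
  also have "\<dots> = (\<Prod>i<N. \<integral>u. ?f i u \<partial>uniform_angle)"
    unfolding flat_null_def
    by (intro P.product_integral_prod integrable_uniform_angle continuous_on_mult cont) auto
  also have "\<dots> = (\<Prod>i<N. if i \<in> S \<inter> T then vm_overlap \<kappa> s t else 1)"
    using integral_vm_ratio[OF st(1)] integral_vm_ratio[OF st(2)] by (intro prod.cong refl, rename_tac i, case_tac "i \<in> S"; case_tac "i \<in> T") (simp_all add: vm_overlap_def)
  also have "\<dots> = vm_overlap \<kappa> s t ^ card ({..<N} \<inter> (S \<inter> T))"
    by (subst prod.inter_restrict[symmetric]) auto
  finally show ?thesis .
qed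

lemma integral_planted_ratio:
  assumes "s \<in> {0..2*pi}"
  shows "(\<integral>x. planted_ratio N \<kappa> S s x \<partial>flat_null N) = 1"
  using integral_planted_ratio_prod[OF assms assms, of N \<kappa> S "{}"] by (simp add: planted_ratio_def)

text \<open>
  The average over the planted subset is taken inside the ratio, as a finite sum, and only the phase is left as a mixing
  parameter. Joint measurability in parameter and data then concerns a real parameter only.
\<close>

definition mixture_ratio :: "nat \<Rightarrow> nat \<Rightarrow> real \<Rightarrow> real \<Rightarrow> (nat \<Rightarrow> real) \<Rightarrow> real" where
  "mixture_ratio N K \<kappa> \<Theta> x =
     (\<Sum>S | S \<subseteq> {..<N} \<and> card S = K. planted_ratio N \<kappa> S \<Theta> x) / real (N choose K)"

lemma integrable_planted_ratio:
  assumes "\<kappa> > 0" "A \<in> sets (flat_null N)"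
  shows "integrable (flat_null N) (\<lambda>x. planted_ratio N \<kappa> S s x * indicator A x)"
proof -
  interpret prob_space "flat_null N" by (rule prob_space_flat_null)
  have "integrable (flat_null N) (planted_ratio N \<kappa> S s)"
    by (rule integrable_const_bound[where B = "max 1 (exp \<kappa> / bessel_I0 \<kappa>) ^ N"])
       (auto simp: planted_ratio_nonneg planted_ratio_le assms measurable_planted_ratio')
  thus ?thesis using assms by (intro integrable_real_mult_indicator)
qed

lemma finite_subsets: "finite {S. S \<subseteq> {..<N::nat} \<and> card S = K}"
  by (rule finite_subset[of _ "Pow {..<N}"]) auto

lemma card_subsets: "card {S. S \<subseteq> {..<N::nat} \<and> card S = K} = N choose K"
  using n_subsets[of "{..<N}" K] by simp

lemma measurable_flat_conditional:
  "flat_conditional N \<kappa> S \<in> uniform_angle \<rightarrow>\<^sub>M prob_algebra (flat_null N)"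
proof (intro measurable_prob_algebraI measurable_subprob_algebra)
  interpret prob_space "flat_null N" by (rule prob_space_flat_null)
  fix \<Theta> assume "\<Theta> \<in> space uniform_angle"
  hence \<Theta>: "\<Theta> \<in> {0..2*pi}" by simp
  show "prob_space (flat_conditional N \<kappa> S \<Theta>)" by (rule prob_space_flat_conditional[OF \<Theta>])
  thus "subprob_space (flat_conditional N \<kappa> S \<Theta>)" by (rule prob_space_imp_subprob_space)
  show "sets (flat_conditional N \<kappa> S \<Theta>) = sets (flat_null N)"
    by (simp add: flat_conditional_density[OF \<Theta>])
next
  interpret prob_space "flat_null N" by (rule prob_space_flat_null)
  fix A assume A[measurable]: "A \<in> sets (flat_null N)"
  note [measurable] = measurable_planted_ratio measurable_planted_ratio'
  have "(\<lambda>\<Theta>. \<integral>\<^sup>+x. ennreal (planted_ratio N \<kappa> S \<Theta> x) * indicator A x \<partial>flat_null N) \<in> borel_measurable uniform_angle"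
    by measurable
  thus "(\<lambda>\<Theta>. emeasure (flat_conditional N \<kappa> S \<Theta>) A) \<in> borel_measurable uniform_angle"
    by (rule measurable_cong[THEN iffD1, rotated]) (simp add: flat_conditional_density emeasure_density A)
qed

lemma measure_flat_conditional:
  assumes \<Theta>: "\<Theta> \<in> {0..2*pi}" and "\<kappa> > 0" and A: "A \<in> sets (flat_null N)"
  shows "measure (flat_conditional N \<kappa> S \<Theta>) A = (\<integral>x. planted_ratio N \<kappa> S \<Theta> x * indicator A x \<partial>flat_null N)"
proof -
  note [measurable] = measurable_planted_ratio' A
  have "emeasure (flat_conditional N \<kappa> S \<Theta>) A = (\<integral>\<^sup>+x. ennreal (planted_ratio N \<kappa> S \<Theta> x * indicator A x) \<partial>flat_null N)"
    by (simp add: flat_conditional_density[OF \<Theta>] emeasure_density ennreal_mult'' ennreal_indicator)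
  also have "\<dots> = ennreal (\<integral>x. planted_ratio N \<kappa> S \<Theta> x * indicator A x \<partial>flat_null N)"
    by (intro nn_integral_eq_integral integrable_planted_ratio assms) (auto simp: planted_ratio_nonneg)
  finally show ?thesis
    by (simp add: measure_def planted_ratio_nonneg Bochner_Integration.integral_nonneg)
qed

lemma measurable_phase_mixture:
  "(\<lambda>S. uniform_angle \<bind> flat_conditional N \<kappa> S) \<in> count_space UNIV \<rightarrow>\<^sub>M prob_algebra (flat_null N)"
proof -
  have "uniform_angle \<bind> flat_conditional N \<kappa> S \<in> space (prob_algebra (flat_null N))" for S
    using measurable_flat_conditional[of N \<kappa> S] prob_space_uniform_angle
    by (auto simp: space_prob_algebra intro!: prob_space_bind' sets_bind')
  thus ?thesis by simp
qed

lemma flat_planted_prob_algebra: "flat_planted N K \<kappa> \<in> space (prob_algebra (flat_null N))"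
  unfolding flat_planted_def
  using prob_space_bind'[OF _ measurable_phase_mixture[of N \<kappa>]] sets_bind'[OF _ measurable_phase_mixture[of N \<kappa>]]
  by (simp add: space_prob_algebra measure_pmf.prob_space_axioms)

lemma measure_flat_planted:
  assumes "K \<le> N" "\<kappa> > 0" and A: "A \<in> sets (flat_null N)"
  shows "measure (flat_planted N K \<kappa>) A =
         (\<integral>\<Theta>. \<integral>x. mixture_ratio N K \<kappa> \<Theta> x * indicator A x \<partial>flat_null N \<partial>uniform_angle)"
proof -
  interpret prob_space uniform_angle by (rule prob_space_uniform_angle)
  let ?F = "{S. S \<subseteq> {..<N} \<and> card S = K}"
  have F: "?F \<noteq> {}" using assms card_subsets[of N K] by (metis card.empty zero_less_binomial_iff less_irrefl)
  have phase: "measure (uniform_angle \<bind> flat_conditional N \<kappa> S) A =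
      (\<integral>\<Theta>. \<integral>x. planted_ratio N \<kappa> S \<Theta> x * indicator A x \<partial>flat_null N \<partial>uniform_angle)" for S
    unfolding measure_bind[OF measurable_prob_algebraD[OF measurable_flat_conditional] A]
    using measure_flat_conditional[OF _ \<open>\<kappa> > 0\<close> A] by (intro Bochner_Integration.integral_cong) auto
  have int: "integrable uniform_angle (\<lambda>\<Theta>. \<integral>x. planted_ratio N \<kappa> S \<Theta> x * indicator A x \<partial>flat_null N)" for S
  proof (rule Bochner_Integration.integrable_cong[THEN iffD1, OF refl])
    show "measure (flat_conditional N \<kappa> S \<Theta>) A = (\<integral>x. planted_ratio N \<kappa> S \<Theta> x * indicator A x \<partial>flat_null N)"
      if "\<Theta> \<in> space uniform_angle" for \<Theta>
      using measure_flat_conditional[OF _ \<open>\<kappa> > 0\<close> A] that by auto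
    show "integrable uniform_angle (\<lambda>\<Theta>. measure (flat_conditional N \<kappa> S \<Theta>) A)"
    proof (rule integrable_const_bound[where B = 1])
      show "(\<lambda>\<Theta>. measure (flat_conditional N \<kappa> S \<Theta>) A) \<in> borel_measurable uniform_angle"
        by (rule measurable_compose[OF measurable_prob_algebraD[OF measurable_flat_conditional] measurable_measure_subprob_algebra[OF A]])
    qed (auto intro!: AE_I2 prob_space.prob_le_1 prob_space_flat_conditional)
  qed
  have "measure (flat_planted N K \<kappa>) A = (\<Sum>S\<in>?F. measure (uniform_angle \<bind> flat_conditional N \<kappa> S) A) / real (card ?F)"
    unfolding flat_planted_def
    using measurable_prob_algebraD[OF measurable_phase_mixture] A F finite_subsets[of N K]
    by (subst measure_pmf.measure_bind[where N = "flat_null N"]) (auto simp: integral_pmf_of_set)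
  also have "\<dots> = (\<integral>\<Theta>. (\<Sum>S\<in>?F. \<integral>x. planted_ratio N \<kappa> S \<Theta> x * indicator A x \<partial>flat_null N) / real (N choose K) \<partial>uniform_angle)"
    by (simp add: phase card_subsets int)
  also have "\<dots> = (\<integral>\<Theta>. \<integral>x. mixture_ratio N K \<kappa> \<Theta> x * indicator A x \<partial>flat_null N \<partial>uniform_angle)"
    unfolding mixture_ratio_def
    by (simp add: sum_distrib_right sum_divide_distrib integrable_planted_ratio assms)
  finally show ?thesis .
qed

text \<open>
  The second moment is the average of \<open>vm_overlap \<kappa> s t ^ card (S \<inter> T)\<close> over independent pairs of phases and of subsets.
  The phases are averaged first: each pair of subsets then contributes at most \<open>1 + B ^ card (S \<inter> T) / B\<close>. The average of
  \<open>B ^ card (S \<inter> T)\<close> over \<open>T\<close> is bounded by \<open>overlap_mgf\<close>.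
\<close>

lemma mixture_ratio_second_moment:
  assumes "K \<le> N" "N > 0" "\<kappa> > 0" "2 / sqrt \<kappa> \<le> pi" and B: "B = 2 * sqrt (pi * \<kappa>)"
  shows "(\<integral>s. \<integral>t. \<integral>x. mixture_ratio N K \<kappa> s x * mixture_ratio N K \<kappa> t x \<partial>flat_null N \<partial>uniform_angle \<partial>uniform_angle)
         \<le> 1 + exp (B * (real K)\<^sup>2 / real N) / B"
proof -
  interpret prob_space uniform_angle by (rule prob_space_uniform_angle)
  interpret Q: prob_space "flat_null N" by (rule prob_space_flat_null)
  let ?F = "{S. S \<subseteq> {..<N} \<and> card S = K}"
  let ?C = "real (N choose K)"
  have C: "?C > 0" using assms by simp
  have B0: "B > 0" using assms by simp
  define M where "M = max 1 (exp \<kappa> / bessel_I0 \<kappa>) ^ N"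
  have M: "\<bar>planted_ratio N \<kappa> S s x\<bar> \<le> M" for S s x
    using planted_ratio_nonneg planted_ratio_le[OF \<open>\<kappa> > 0\<close>] by (simp add: M_def)
  note [measurable] = measurable_planted_ratio'
  have int: "integrable (flat_null N) (\<lambda>x. planted_ratio N \<kappa> S s x * planted_ratio N \<kappa> T t x)" for S T s t
    by (rule Q.integrable_const_bound[where B = "M * M"]) (auto intro!: AE_I2 mult_mono simp: abs_mult M M[THEN order_trans[OF abs_ge_zero]] simp del: abs_mult_self_eq)
  have ov: "(\<integral>x. mixture_ratio N K \<kappa> s x * mixture_ratio N K \<kappa> t x \<partial>flat_null N)
        = (\<Sum>S\<in>?F. \<Sum>T\<in>?F. vm_overlap \<kappa> s t ^ card (S \<inter> T)) / ?C\<^sup>2"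
    if "s \<in> {0..2*pi}" "t \<in> {0..2*pi}" for s t
  proof -
    have "(\<integral>x. mixture_ratio N K \<kappa> s x * mixture_ratio N K \<kappa> t x \<partial>flat_null N) =
          (\<integral>x. (\<Sum>S\<in>?F. \<Sum>T\<in>?F. planted_ratio N \<kappa> S s x * planted_ratio N \<kappa> T t x) / ?C\<^sup>2 \<partial>flat_null N)"
      by (simp add: mixture_ratio_def sum_product power2_eq_square)
    also have "\<dots> = (\<Sum>S\<in>?F. \<Sum>T\<in>?F. \<integral>x. planted_ratio N \<kappa> S s x * planted_ratio N \<kappa> T t x \<partial>flat_null N) / ?C\<^sup>2"
      by (simp add: int)
    also have "\<dots> = (\<Sum>S\<in>?F. \<Sum>T\<in>?F. vm_overlap \<kappa> s t ^ card (S \<inter> T)) / ?C\<^sup>2"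
      using that by (intro arg_cong2[where f = "(/)"] sum.cong refl) (auto simp: integral_planted_ratio_prod Int_absorb1 le_infI1)
    finally show ?thesis .
  qed
  have ob: "\<bar>vm_overlap \<kappa> s t ^ m\<bar> \<le> vm_peak \<kappa> ^ m" if "s \<in> {0..2*pi}" "t \<in> {0..2*pi}" for s t m
    using vm_overlap_nonneg vm_overlap_le_peak[OF that] by (simp add: power_abs power_mono)
  have i1: "integrable uniform_angle (\<lambda>t. vm_overlap \<kappa> s t ^ m)" if "s \<in> {0..2*pi}" for s m
    by (rule integrable_const_bound[where B = "vm_peak \<kappa> ^ m"]) (use that ob in \<open>auto intro!: AE_I2\<close>)
  have i2: "integrable uniform_angle (\<lambda>s. \<integral>t. vm_overlap \<kappa> s t ^ m \<partial>uniform_angle)" for m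
  proof (rule integrable_const_bound[where B = "vm_peak \<kappa> ^ m"])
    show "AE s in uniform_angle. norm (\<integral>t. vm_overlap \<kappa> s t ^ m \<partial>uniform_angle) \<le> vm_peak \<kappa> ^ m"
    proof (rule AE_I2)
      fix s assume s: "s \<in> space uniform_angle"
      have "norm (\<integral>t. vm_overlap \<kappa> s t ^ m \<partial>uniform_angle) \<le> (\<integral>t. vm_peak \<kappa> ^ m \<partial>uniform_angle)"
        using s ob by (intro Bochner_Integration.integral_norm_bound_integral i1) auto
      thus "norm (\<integral>t. vm_overlap \<kappa> s t ^ m \<partial>uniform_angle) \<le> vm_peak \<kappa> ^ m" by simp
    qed
  qed measurable
  have "(\<integral>s. \<integral>t. \<integral>x. mixture_ratio N K \<kappa> s x * mixture_ratio N K \<kappa> t x \<partial>flat_null N \<partial>uniform_angle \<partial>uniform_angle)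
      = (\<integral>s. \<integral>t. (\<Sum>S\<in>?F. \<Sum>T\<in>?F. vm_overlap \<kappa> s t ^ card (S \<inter> T)) / ?C\<^sup>2 \<partial>uniform_angle \<partial>uniform_angle)"
    by (intro Bochner_Integration.integral_cong refl ov) auto
  also have "\<dots> = (\<integral>s. (\<Sum>S\<in>?F. \<Sum>T\<in>?F. \<integral>t. vm_overlap \<kappa> s t ^ card (S \<inter> T) \<partial>uniform_angle) / ?C\<^sup>2 \<partial>uniform_angle)"
    by (intro Bochner_Integration.integral_cong refl) (simp add: i1)
  also have "\<dots> = (\<Sum>S\<in>?F. \<Sum>T\<in>?F. \<integral>s. \<integral>t. vm_overlap \<kappa> s t ^ card (S \<inter> T) \<partial>uniform_angle \<partial>uniform_angle) / ?C\<^sup>2"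
    by (simp add: i2)
  also have "\<dots> \<le> (\<Sum>S\<in>?F. \<Sum>T\<in>?F. 1 + B ^ card (S \<inter> T) / B) / ?C\<^sup>2"
    using vm_overlap_moment[OF assms(3,4) B] by (intro divide_right_mono sum_mono) auto
  also have "\<dots> = (?C\<^sup>2 + (\<Sum>S\<in>?F. \<Sum>T\<in>?F. B ^ card (S \<inter> T)) / B) / ?C\<^sup>2"
    by (simp add: sum.distrib card_subsets power2_eq_square sum_divide_distrib)
  also have "\<dots> \<le> (?C\<^sup>2 + (\<Sum>S\<in>?F. ?C * exp (B * (real K)\<^sup>2 / real N)) / B) / ?C\<^sup>2"
    using B0 assms(2) by (intro divide_right_mono add_left_mono sum_mono overlap_mgf) auto
  also have "\<dots> = 1 + exp (B * (real K)\<^sup>2 / real N) / B"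
    using C B0 by (simp add: card_subsets field_simps power2_eq_square)
  finally show ?thesis .
qed

text \<open>
  With \<open>A\<close> the rejection region, the sum of the two errors is 1 minus the excess of the planted over the null
  probability of \<open>A\<close>, so the second moment bound applies to any test.
\<close>

lemma flat_detection_error_ge:
  assumes "K \<le> N" "N > 0" "\<kappa> > 0" "2 / sqrt \<kappa> \<le> pi" and B: "B = 2 * sqrt (pi * \<kappa>)"
    and \<phi>: "\<phi> \<in> measurable (flat_null N) (count_space UNIV)"
  shows "p_fa (flat_null N) \<phi> + p_miss (flat_planted N K \<kappa>) \<phi> \<ge> 1 - sqrt (exp (B * (real K)\<^sup>2 / real N) / B)"
proof -
  interpret T: prob_space uniform_angle by (rule prob_space_uniform_angle)
  let ?F = "{S. S \<subseteq> {..<N} \<and> card S = K}"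
  define M where "M = max 1 (exp \<kappa> / bessel_I0 \<kappa>) ^ N"
  have M: "\<bar>planted_ratio N \<kappa> S s x\<bar> \<le> M" for S s x
    using planted_ratio_nonneg planted_ratio_le[OF \<open>\<kappa> > 0\<close>] by (simp add: M_def)
  note [measurable] = measurable_planted_ratio
  define A where "A = {x \<in> space (flat_null N). \<phi> x}"
  have A: "A \<in> sets (flat_null N)" unfolding A_def using \<phi> by measurable
  have P: "prob_space (flat_planted N K \<kappa>)" "sets (flat_planted N K \<kappa>) = sets (flat_null N)"
    using flat_planted_prob_algebra[of N K \<kappa>] by (auto simp: space_prob_algebra)
  have sp: "space (flat_planted N K \<kappa>) = space (flat_null N)" using P(2) by (rule sets_eq_imp_space_eq)
  have "p_miss (flat_planted N K \<kappa>) \<phi> = measure (flat_planted N K \<kappa>) (space (flat_planted N K \<kappa>) - A)"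
    unfolding p_miss_def A_def sp by (intro arg_cong2[where f = measure]) auto
  also have "\<dots> = 1 - measure (flat_planted N K \<kappa>) A"
    using prob_space.prob_compl[OF P(1)] A P(2) by simp
  finally have miss: "p_miss (flat_planted N K \<kappa>) \<phi> = 1 - measure (flat_planted N K \<kappa>) A" .
  have "measure (flat_planted N K \<kappa>) A - measure (flat_null N) A
     \<le> sqrt ((\<integral>s. \<integral>t. \<integral>x. mixture_ratio N K \<kappa> s x * mixture_ratio N K \<kappa> t x \<partial>flat_null N \<partial>uniform_angle \<partial>uniform_angle) - 1)"
    unfolding measure_flat_planted[OF assms(1,3) A]
  proof (rule mixture_discrepancy_le[OF prob_space_uniform_angle prob_space_flat_null _ _ _ A, where C = M])
    show "(\<lambda>(t, x). mixture_ratio N K \<kappa> t x) \<in> borel_measurable (uniform_angle \<Otimes>\<^sub>M flat_null N)"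
      unfolding mixture_ratio_def by measurable
    fix t assume t: "t \<in> space uniform_angle"
    show "\<bar>mixture_ratio N K \<kappa> t x\<bar> \<le> M" for x
    proof -
      have "\<bar>mixture_ratio N K \<kappa> t x\<bar> \<le> (\<Sum>S\<in>?F. \<bar>planted_ratio N \<kappa> S t x\<bar>) / real (N choose K)"
        by (simp add: mixture_ratio_def divide_right_mono)
      also have "\<dots> \<le> (\<Sum>S\<in>?F. M) / real (N choose K)"
        by (intro divide_right_mono sum_mono M) auto
      also have "\<dots> = M" using assms(1) by (simp add: card_subsets)
      finally show ?thesis .
    qed
    have "(\<integral>x. mixture_ratio N K \<kappa> t x \<partial>flat_null N) = (\<Sum>S\<in>?F. \<integral>x. planted_ratio N \<kappa> S t x \<partial>flat_null N) / real (N choose K)"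
      using integrable_planted_ratio[OF assms(3) sets.top, of N _ t]
      unfolding mixture_ratio_def
      by (simp add: Bochner_Integration.integral_sum cong: Bochner_Integration.integrable_cong)
    also have "\<dots> = 1" using t assms(1) by (simp add: integral_planted_ratio card_subsets)
    finally show "(\<integral>x. mixture_ratio N K \<kappa> t x \<partial>flat_null N) = 1" .
  qed
  also have "\<dots> \<le> sqrt (exp (B * (real K)\<^sup>2 / real N) / B)"
    using mixture_ratio_second_moment[OF assms(1-5)] by simp
  finally show ?thesis unfolding miss p_fa_def A_def[symmetric] by simp
qed

section \<open>Impossibility of weak detection\<close>

theorem corollary4:
  fixes \<alpha> c :: real and K :: "nat \<Rightarrow> nat" and \<kappa> :: "nat \<Rightarrow> real"
  assumes "0 < \<alpha>" and "\<alpha> < 1 / 2"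
    and "0 < c" and "c < (1 - 2 * \<alpha>) / (2 * sqrt pi)"
    and "\<forall>\<^sub>F N in sequentially. 1 \<le> K N \<and> K N \<le> N \<and> \<bar>real (K N) - real N powr \<alpha>\<bar> < 1"
    and "\<forall>\<^sub>F N in sequentially. 0 < \<kappa> N \<and>
           1 / sqrt (\<kappa> N) = (real (K N))\<^sup>2 / (c * real N * ln (real N))"
  shows "weak_detection_impossible (\<lambda>N. flat_planted N (K N) (\<kappa> N)) (\<lambda>N. flat_null N)"
proof -
  define B where "B = (\<lambda>N. 2 * sqrt (pi * \<kappa> N))"
  define r where "r = (\<lambda>N. sqrt (exp (B N * (real (K N))\<^sup>2 / real N) / B N))"
  \<comment> \<open>The left-hand side is \<open>1 / sqrt (\<kappa> N)\<close>. Rounding is absorbed by \<open>K N \<le> 2 * N powr \<alpha>\<close>.\<close>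
  have inv_sqrt: "eventually (\<lambda>N. (real (K N))\<^sup>2 / (c * real N * ln (real N)) \<le> 4 / c * real N powr (2 * \<alpha> - 1) / ln (real N)) sequentially"
    using assms(5) eventually_gt_at_top[of 2]
  proof eventually_elim
    case (elim N)
    have ln: "ln (real N) > 0" using elim by simp
    have "1 \<le> real N powr \<alpha>" using elim assms(1) by (intro ge_one_powr_ge_zero) auto
    hence "real (K N) \<le> 2 * real N powr \<alpha>" using elim by linarith
    hence "(real (K N))\<^sup>2 \<le> (2 * real N powr \<alpha>)\<^sup>2" by (intro power_mono) auto
    also have "\<dots> = 4 * (real N powr (2 * \<alpha> - 1) * real N)"
      using elim by (simp add: power_mult_distrib power2_eq_square powr_diff flip: powr_add)
    finally have "(real (K N))\<^sup>2 / (c * real N * ln (real N)) \<le> 4 * (real N powr (2 * \<alpha> - 1) * real N) / (c * real N * ln (real N))"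
      using assms(3) ln by (intro divide_right_mono) auto
    also have "\<dots> = 4 / c * real N powr (2 * \<alpha> - 1) / ln (real N)" using elim by simp
    finally show ?case .
  qed
  have lim: "((\<lambda>N. D / ln (real N)) \<longlongrightarrow> 0) sequentially" for D :: real
    by real_asymp
  have small: "eventually (\<lambda>N. 2 / sqrt (\<kappa> N) \<le> pi) sequentially"
    using inv_sqrt assms(6) eventually_gt_at_top[of 2] order_tendstoD(2)[OF lim[of "8 / c"] pi_gt_zero]
  proof eventually_elim
    case (elim N)
    have ln: "ln (real N) > 0" using elim by simp
    have "2 / sqrt (\<kappa> N) = 2 * (1 / sqrt (\<kappa> N))" by simp
    also have "\<dots> \<le> 2 * (4 / c * real N powr (2 * \<alpha> - 1) / ln (real N))" using elim by simp
    also have "\<dots> \<le> 2 * (4 / c * real N powr 0 / ln (real N))"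
      using assms elim ln by (intro mult_left_mono divide_right_mono powr_mono) auto
    also have "\<dots> \<le> pi" using elim by simp
    finally show ?case .
  qed
  have "eventually (\<lambda>N. r N \<le> sqrt (2 / (sqrt pi * c) / ln (real N))) sequentially"
    using inv_sqrt assms(5,6) eventually_gt_at_top[of 2]
  proof eventually_elim
    case (elim N)
    have ln: "ln (real N) > 0" using elim by simp
    have pos: "real N > 0" "real (K N) > 0" "sqrt (\<kappa> N) > 0" using elim by auto
    have s: "sqrt (\<kappa> N) * (real (K N))\<^sup>2 = c * real N * ln (real N)"
    proof -
      have cross: "1 / a = k / b \<Longrightarrow> a > 0 \<Longrightarrow> b > 0 \<Longrightarrow> a * k = b" for a b k :: real
        by (simp add: field_simps)
      show ?thesis using elim pos ln assms(3) by (intro cross) auto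
    qed
    \<comment> \<open>The calibration of \<open>\<kappa> N\<close> makes the exponent logarithmic in \<open>N\<close>, with no dependence on \<open>K N\<close>.\<close>
    have "B N * (real (K N))\<^sup>2 / real N = 2 * sqrt pi * (sqrt (\<kappa> N) * (real (K N))\<^sup>2) / real N"
      by (simp add: B_def real_sqrt_mult)
    also have "\<dots> = (2 * sqrt pi * c) * ln (real N)" unfolding s using pos by simp
    finally have e: "exp (B N * (real (K N))\<^sup>2 / real N) = real N powr (2 * sqrt pi * c)"
      using pos by (simp add: powr_def)
    have "exp (B N * (real (K N))\<^sup>2 / real N) / B N
        = real N powr (2 * sqrt pi * c) / (2 * sqrt pi) * (1 / sqrt (\<kappa> N))"
      unfolding e by (simp add: B_def real_sqrt_mult)
    also have "\<dots> \<le> real N powr (2 * sqrt pi * c) / (2 * sqrt pi) * (4 / c * real N powr (2 * \<alpha> - 1) / ln (real N))"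
      using elim by (intro mult_left_mono) auto
    also have "\<dots> = 2 / (sqrt pi * c) * real N powr (2 * sqrt pi * c + (2 * \<alpha> - 1)) / ln (real N)"
      unfolding powr_add[of _ "2 * sqrt pi * c"] by (simp add: field_simps)
    also have "\<dots> \<le> 2 / (sqrt pi * c) * real N powr 0 / ln (real N)"
    proof -
      \<comment> \<open>This is where the threshold on \<open>c\<close> enters; the logarithm in the denominator then gives the decay.\<close>
      have "2 * sqrt pi * c + (2 * \<alpha> - 1) \<le> 0" using assms(4) by (simp add: field_simps)
      thus ?thesis
        using assms elim ln by (intro mult_left_mono divide_right_mono powr_mono) auto
    qed
    also have "\<dots> = 2 / (sqrt pi * c) / ln (real N)" using pos by simp
    finally show ?case unfolding r_def by (rule real_sqrt_le_mono)
  qed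
  moreover have "eventually (\<lambda>N. 0 \<le> r N) sequentially"
    using assms(6) by eventually_elim (simp add: r_def B_def)
  moreover have "(\<lambda>N. sqrt (2 / (sqrt pi * c) / ln (real N))) \<longlonglongrightarrow> 0"
    using tendsto_real_sqrt[OF lim[of "2 / (sqrt pi * c)"]] by simp
  ultimately have r0: "r \<longlonglongrightarrow> 0"
    by (rule_tac tendsto_sandwich[OF _ _ tendsto_const])
  show ?thesis
    unfolding weak_detection_impossible_def
  proof (intro allI impI exI[of _ r] conjI r0)
    fix \<phi> :: "nat \<Rightarrow> (nat \<Rightarrow> real) \<Rightarrow> bool"
    assume \<phi>: "\<forall>N. \<phi> N \<in> measurable (flat_null N) (count_space UNIV)"
    show "\<forall>\<^sub>F N in sequentially. p_fa (flat_null N) (\<phi> N) + p_miss (flat_planted N (K N) (\<kappa> N)) (\<phi> N) \<ge> 1 - r N"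
      using small assms(5,6)
    proof eventually_elim
      case (elim N)
      thus ?case unfolding r_def using \<phi>
        by (intro flat_detection_error_ge) (auto simp: B_def)
    qed
  qed
qed

end
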